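(* Let $\alpha\in(0,1]$ and let $\rho,m_1,m_2$ satisfy $\rho>0$ and $0<m_2\le m_1$. Assume that $\mu,\tau\in\mathbb{R}_+$ satisfy $\tau=\frac1\rho$ and $\mu=\frac{2+\rho m_1}{\rho m_2}$. Then $$\mathcal{X}_{sm}^{\rho,m_1,m_2}(\alpha)\subseteq\mathcal{X}_{ss}^{\mu,\tau}(\alpha)\qquad\text{and}\qquad \varphi_{ss}^{\mu,\tau}(\alpha)\le\varphi_{sm}^{\rho,m_1,m_2}(\alpha).$$
   Context: $(\Omega,\mathcal{F},\mathbb{P})$ is a probability space and $\Xi:\Omega\to\mathbb{R}^d$ is a random vector. $\mathcal{X}=\{x\in\mathbb{R}^n : g(x)\ge 0\}$ is nonempty and compact, with $g:\mathbb{R}^n\to\mathbb{R}^m$ twice differentiable. The objective $\varphi:\mathbb{R}^n\to\mathbb{R}$ is twice continuously differentiable. The scalar function $f(x,\xi)$, $x\in\mathbb{R}^n$, $\xi\in\mathbb{R}^d$, is real-valued and twice continuously differentiable. Write $[a]_+:=\max\{a,0\}$. Smooth sigmoidal (SS) problem: with $\psi_{sm}^{\rho,m_1,m_2}(z):=\frac{1+\rho m_1}{1+\rho m_2e^{-z/\rho}}$, let $$\mathcal{X}_{sm}^{\rho,m_1,m_2}(\alpha):=\{x\in\mathcal{X} : \mathbb{E}[\psi_{sm}^{\rho,m_1,m_2}(f(x,\Xi))]\le\alpha\},$$ and let $\varphi_{sm}^{\rho,m_1,m_2}(\alpha)$ be the optimal value of minimizing $\varphi$ over this set. SigVaR problem: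 with $\psi_{ss}^{\mu,\tau}(z):=\left[2\,\frac{1+\mu}{\mu+e^{-\tau z}}-1\right]_+$ and $\text{SigVaR}_{1-\alpha}^{\mu,\tau}(Z):=\inf\{t\in\mathbb{R} : \mathbb{E}[\psi_{ss}^{\mu,\tau}(Z-t)]\le\alpha\}$, let $$\mathcal{X}_{ss}^{\mu,\tau}(\alpha):=\{x\in\mathcal{X} : \text{SigVaR}_{1-\alpha}^{\mu,\tau}(f(x,\Xi))\le 0\},$$ equivalently $\{x\in\mathcal{X} : \mathbb{E}[\psi_{ss}^{\mu,\tau}(f(x,\Xi))]\le\alpha\}$, and let $\varphi_{ss}^{\mu,\tau}(\alpha)$ be the optimal value of minimizing $\varphi$ over this set. The optimal value over an empty feasible set is $+\infty$. *)

theory Defs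
  imports "HOL-Probability.Probability"
begin

text \<open>Second-order Frechet differentiability on the whole space, with derivatives taken in the
  operator norm; \<open>C2\<close> additionally requires the second derivative to be continuous.\<close>

definition twice_differentiable :: "('a::real_normed_vector \<Rightarrow> 'b::real_normed_vector) \<Rightarrow> bool"
  where "twice_differentiable h \<longleftrightarrow>
    (\<exists>(h' :: 'a \<Rightarrow> 'a \<Rightarrow>\<^sub>L 'b) (h'' :: 'a \<Rightarrow> 'a \<Rightarrow>\<^sub>L 'a \<Rightarrow>\<^sub>L 'b).
       (\<forall>x. (h has_derivative blinfun_apply (h' x)) (at x)) \<and>
       (\<forall>x. (h' has_derivative blinfun_apply (h'' x)) (at x)))"

definition C2 :: "('a::real_normed_vector \<Rightarrow> 'b::real_normed_vector) \<Rightarrow> bool"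
  where "C2 h \<longleftrightarrow>
    (\<exists>(h' :: 'a \<Rightarrow> 'a \<Rightarrow>\<^sub>L 'b) (h'' :: 'a \<Rightarrow> 'a \<Rightarrow>\<^sub>L 'a \<Rightarrow>\<^sub>L 'b).
       (\<forall>x. (h has_derivative blinfun_apply (h' x)) (at x)) \<and>
       (\<forall>x. (h' has_derivative blinfun_apply (h'' x)) (at x)) \<and>
       continuous_on UNIV h'')"

text \<open>The order on \<open>real^'m\<close> is componentwise.\<close>

definition constraint_set :: "(real^'n \<Rightarrow> real^'m) \<Rightarrow> (real^'n) set"
  where "constraint_set g = {x. 0 \<le> g x}"

definition opt_val :: "('a \<Rightarrow> real) \<Rightarrow> 'a set \<Rightarrow> ereal"
  where "opt_val \<phi> S = (INF x\<in>S. ereal (\<phi> x))"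

definition psi_sm :: "real \<Rightarrow> real \<Rightarrow> real \<Rightarrow> real \<Rightarrow> real"
  where "psi_sm \<rho> m1 m2 z = (1 + \<rho> * m1) / (1 + \<rho> * m2 * exp (- z / \<rho>))"

definition psi_ss :: "real \<Rightarrow> real \<Rightarrow> real \<Rightarrow> real"
  where "psi_ss \<mu> \<tau> z = max (2 * ((1 + \<mu>) / (\<mu> + exp (- \<tau> * z))) - 1) 0"

text \<open>\<open>sigvar M \<mu> \<tau> \<alpha> Z\<close> is the SigVaR at confidence level \<open>1 - \<alpha>\<close>. The infimum is taken in
  the extended reals, so that it is meaningful also when the set is empty or unbounded below.\<close>

definition sigvar :: "'w measure \<Rightarrow> real \<Rightarrow> real \<Rightarrow> real \<Rightarrow> ('w \<Rightarrow> real) \<Rightarrow> ereal"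
  where "sigvar M \<mu> \<tau> \<alpha> Z =
    Inf {ereal t | t. (\<integral>\<omega>. psi_ss \<mu> \<tau> (Z \<omega> - t) \<partial>M) \<le> \<alpha>}"

definition X_sm :: "'w measure \<Rightarrow> ('w \<Rightarrow> real^'d) \<Rightarrow> (real^'n \<Rightarrow> real^'m) \<Rightarrow>
    ((real^'n) \<times> (real^'d) \<Rightarrow> real) \<Rightarrow> real \<Rightarrow> real \<Rightarrow> real \<Rightarrow> real \<Rightarrow> (real^'n) set"
  where "X_sm M \<Xi> g f \<rho> m1 m2 \<alpha> =
    {x \<in> constraint_set g. (\<integral>\<omega>. psi_sm \<rho> m1 m2 (f (x, \<Xi> \<omega>)) \<partial>M) \<le> \<alpha>}"

definition X_ss :: "'w measure \<Rightarrow> ('w \<Rightarrow> real^'d) \<Rightarrow> (real^'n \<Rightarrow> real^'m) \<Rightarrow>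
    ((real^'n) \<times> (real^'d) \<Rightarrow> real) \<Rightarrow> real \<Rightarrow> real \<Rightarrow> real \<Rightarrow> (real^'n) set"
  where "X_ss M \<Xi> g f \<mu> \<tau> \<alpha> =
    {x \<in> constraint_set g. sigvar M \<mu> \<tau> \<alpha> (\<lambda>\<omega>. f (x, \<Xi> \<omega>)) \<le> 0}"

end

theory Submission
  imports Defs
begin

text \<open>The whole argument is a pointwise comparison of the two approximations of the indicator
  function: for the stated parameters the SigVaR kernel lies below the smooth sigmoid. With
  \<open>a = \<rho> m1\<close>, \<open>b = \<rho> m2\<close> and \<open>y = b exp (- z / \<rho>)\<close>, clearing denominators and
  keeping \<open>y\<close> fixed leaves an inequality that is tightest for the largest admissible \<open>b\<close>,
  namely \<open>b = a\<close>, where the difference of the two sides is exactly \<open>(a - y)\<^sup>2\<close>. In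
  particular, for \<open>m1 = m2\<close> both functions take the value \<open>1\<close> at \<open>z = 0\<close>, and \<open>\<mu>\<close> is
  the value that makes them tangent there (\<open>psi_ss_le_psi_sm\<close>).

  The inequality passes to expectations, because the smooth sigmoid is bounded and continuous
  (\<open>integrable_psi_sm\<close>). Hence at a point of the smooth feasible set \<open>t = 0\<close> is admissible
  in the infimum that defines SigVaR (\<open>sigvar_nonpos\<close>), so SigVaR is at most \<open>0\<close>. The optimal
  values are then compared by monotonicity of the infimum.\<close>

text \<open>The left-hand numerator increases with \<open>b\<close>, so the worst case is \<open>b = a\<close>, where the
  cross-multiplied inequality says that \<open>(a - y)\<^sup>2\<close> is nonnegative.\<close>

lemma sigmoid_fraction_le:
  fixes a b y :: real
  assumes "0 < b" "b \<le> a" "0 < y"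
  shows "(2 * b + 2 + a - y) / (2 + a + y) \<le> (1 + a) / (1 + y)"
proof -
  have "(2 * b + 2 + a - y) * (1 + y) \<le> (2 * a + 2 + a - y) * (1 + y)"
    using assms by (intro mult_right_mono) auto
  also have "\<dots> = (1 + a) * (2 + a + y) - (a - y)\<^sup>2"
    by (simp add: power2_eq_square algebra_simps)
  also have "\<dots> \<le> (1 + a) * (2 + a + y)"
    by simp
  finally show ?thesis
    using assms by (simp add: divide_simps mult.commute)
qed

lemma psi_sm_nonneg:
  assumes "0 < \<rho>" "0 \<le> m1" "0 \<le> m2"
  shows "0 \<le> psi_sm \<rho> m1 m2 z"
  using assms by (simp add: psi_sm_def)

lemma psi_sm_le:
  assumes "0 < \<rho>" "0 \<le> m1" "0 \<le> m2"
  shows "psi_sm \<rho> m1 m2 z \<le> 1 + \<rho> * m1"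
proof -
  have "(1 + \<rho> * m1) / (1 + \<rho> * m2 * exp (- z / \<rho>)) \<le> (1 + \<rho> * m1) / 1"
    using assms by (intro divide_left_mono) (auto intro!: add_pos_nonneg)
  then show ?thesis by (simp add: psi_sm_def)
qed

lemma psi_ss_le_psi_sm:
  assumes "0 < \<rho>" "0 < m2" "m2 \<le> m1"
  shows "psi_ss ((2 + \<rho> * m1) / (\<rho> * m2)) (1 / \<rho>) z \<le> psi_sm \<rho> m1 m2 z"
proof -
  define a b e where "a = \<rho> * m1" and "b = \<rho> * m2" and "e = exp (- z / \<rho>)"
  have pos: "0 < b" "b \<le> a" "0 < e"
    using assms by (auto simp: a_def b_def e_def)
  have D: "0 < 2 + a + b * e"
    using pos by (intro add_pos_pos) auto
  have "1 + (2 + a) / b = (b + 2 + a) / b" and "(2 + a) / b + e = (2 + a + b * e) / b"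
    using pos by (simp_all add: field_simps)
  then have "(1 + (2 + a) / b) / ((2 + a) / b + e) = (b + 2 + a) / (2 + a + b * e)"
    using pos by simp
  then have "2 * ((1 + (2 + a) / b) / ((2 + a) / b + e)) - 1
      = (2 * (b + 2 + a) - (2 + a + b * e)) / (2 + a + b * e)"
    using D by (simp only: diff_divide_distrib) simp
  also have "\<dots> = (2 * b + 2 + a - b * e) / (2 + a + b * e)"
    by (rule arg_cong[where f = "\<lambda>u. u / _"]) simp
  also have "\<dots> \<le> (1 + a) / (1 + b * e)"
    using pos by (intro sigmoid_fraction_le) auto
  finally have "2 * ((1 + (2 + a) / b) / ((2 + a) / b + e)) - 1 \<le> psi_sm \<rho> m1 m2 z"
    by (simp add: psi_sm_def a_def b_def e_def)
  then show ?thesis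
    using psi_sm_nonneg[of \<rho> m1 m2 z] assms
    by (simp add: psi_ss_def a_def b_def e_def)
qed

text \<open>The Bochner integral of a non-integrable function is \<open>0\<close>, so the comparison of expectations
  would break down if the larger of the two functions were not integrable.\<close>

lemma (in prob_space) integrable_psi_sm:
  assumes "Z \<in> borel_measurable M" "0 < \<rho>" "0 \<le> m1" "0 \<le> m2"
  shows "integrable M (\<lambda>\<omega>. psi_sm \<rho> m1 m2 (Z \<omega>))"
proof (rule integrable_const_bound)
  show "AE \<omega> in M. norm (psi_sm \<rho> m1 m2 (Z \<omega>)) \<le> 1 + \<rho> * m1"
    using psi_sm_le[OF assms(2-4)] psi_sm_nonneg[OF assms(2-4)] by simp
  show "(\<lambda>\<omega>. psi_sm \<rho> m1 m2 (Z \<omega>)) \<in> borel_measurable M"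
    using assms(1) unfolding psi_sm_def by measurable
qed

lemma sigvar_nonpos:
  assumes "(\<integral>\<omega>. psi_ss \<mu> \<tau> (Z \<omega>) \<partial>M) \<le> \<alpha>"
  shows "sigvar M \<mu> \<tau> \<alpha> Z \<le> 0"
  unfolding sigvar_def zero_ereal_def
  by (rule Inf_lower) (use assms in \<open>auto intro!: exI[of _ 0]\<close>)

lemma C2_imp_continuous_on:
  assumes "C2 h"
  shows "continuous_on UNIV h"
  using assms unfolding C2_def
  by (meson continuous_at_imp_continuous_on has_derivative_continuous)

lemma opt_val_antimono: "S \<subseteq> T \<Longrightarrow> opt_val \<phi> T \<le> opt_val \<phi> S"
  unfolding opt_val_def by (rule INF_superset_mono) auto

theorem proposition4:
  fixes M :: "'w measure"
    and \<Xi> :: "'w \<Rightarrow> real^'d"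
    and g :: "real^'n \<Rightarrow> real^'m"
    and \<phi> :: "real^'n \<Rightarrow> real"
    and f :: "(real^'n) \<times> (real^'d) \<Rightarrow> real"
    and \<alpha> \<rho> m1 m2 \<mu> \<tau> :: real
  assumes "prob_space M"
    and "\<Xi> \<in> borel_measurable M"
    and "twice_differentiable g"
    and "constraint_set g \<noteq> {}"
    and "compact (constraint_set g)"
    and "C2 \<phi>"
    and "C2 f"
    and "0 < \<alpha>" and "\<alpha> \<le> 1"
    and "\<rho> > 0"
    and "0 < m2" and "m2 \<le> m1"
    and "\<mu> \<ge> 0" and "\<tau> \<ge> 0"
    and "\<tau> = 1 / \<rho>"
    and "\<mu> = (2 + \<rho> * m1) / (\<rho> * m2)"
  shows "X_sm M \<Xi> g f \<rho> m1 m2 \<alpha> \<subseteq> X_ss M \<Xi> g f \<mu> \<tau> \<alpha> \<and>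
    opt_val \<phi> (X_ss M \<Xi> g f \<mu> \<tau> \<alpha>) \<le> opt_val \<phi> (X_sm M \<Xi> g f \<rho> m1 m2 \<alpha>)"
proof -
  interpret prob_space M by fact
  have "X_sm M \<Xi> g f \<rho> m1 m2 \<alpha> \<subseteq> X_ss M \<Xi> g f \<mu> \<tau> \<alpha>"
  proof
    fix x assume "x \<in> X_sm M \<Xi> g f \<rho> m1 m2 \<alpha>"
    then have x: "x \<in> constraint_set g"
      and le: "(\<integral>\<omega>. psi_sm \<rho> m1 m2 (f (x, \<Xi> \<omega>)) \<partial>M) \<le> \<alpha>"
      by (auto simp: X_sm_def)
    have "continuous_on UNIV (\<lambda>\<xi>. f (x, \<xi>))"
      by (intro continuous_on_compose2[OF C2_imp_continuous_on[OF \<open>C2 f\<close>]] continuous_intros) auto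
    then have "(\<lambda>\<omega>. f (x, \<Xi> \<omega>)) \<in> borel_measurable M"
      using \<open>\<Xi> \<in> borel_measurable M\<close>
      by (rule borel_measurable_continuous_on)
    then have "integrable M (\<lambda>\<omega>. psi_sm \<rho> m1 m2 (f (x, \<Xi> \<omega>)))"
      using assms by (intro integrable_psi_sm) auto
    then have "(\<integral>\<omega>. psi_ss \<mu> \<tau> (f (x, \<Xi> \<omega>)) \<partial>M)
        \<le> (\<integral>\<omega>. psi_sm \<rho> m1 m2 (f (x, \<Xi> \<omega>)) \<partial>M)"
      using assms by (intro integral_mono') (auto intro!: psi_ss_le_psi_sm psi_sm_nonneg)
    with le have "sigvar M \<mu> \<tau> \<alpha> (\<lambda>\<omega>. f (x, \<Xi> \<omega>)) \<le> 0"
      by (intro sigvar_nonpos) simp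
    with x show "x \<in> X_ss M \<Xi> g f \<mu> \<tau> \<alpha>"
      by (simp add: X_ss_def)
  qed
  then show ?thesis
    by (simp add: opt_val_antimono)
qed

end
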